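(* Let $\mathbf{w}\in\Sigma^\omega$ be a linearly recurrent word with $\mathbf{A}_\mathbf{w},\mathbf{R}_\mathbf{w}<\infty$. Then for every $n\ge1$, $\mathbf{w}[0..n-1]$ has a string attractor of size $O(\mathbf{A}_\mathbf{w}\log\mathbf{R}_\mathbf{w})$, where the implied constant is absolute (in particular independent of $n$).
   Context: $\Sigma$ is a finite alphabet; words are indexed from $0$. The appearance constant $\mathbf{A}_\mathbf{w}$ is the least constant $C$ such that for every $m\ge1$, every length-$m$ factor of $\mathbf{w}$ has an occurrence in the prefix of length at most $Cm$. $\mathbf{w}$ is linearly recurrent if every factor occurs infinitely often and there is a constant $C$ such that, for every $m$, two consecutive occurrences of every length-$m$ factor (and also the beginning of the word and the first occurrence) are separated by at most $Cm$ positions; the recurrence constant $\mathbf{R}_\mathbf{w}$ is the least such $C$. A string attractor of a finite word $x=x[0..n-1]$ is a set $S\subseteq\{0,\ldots,n-1\}$ such that every nonempty factor of $x$ has an occurrence $x[p..q]$ with $p\le i\le q$ for some $i\in S$.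
   Formalization: The bound O(A_w log R_w) is stated as O(A_w (1 + log R_w)): for a constant word R_w = 1, so log R_w = 0 while an attractor needs at least one position; every other word has R_w ≥ 2, where the two bounds agree up to an absolute constant. *)

theory Defs
  imports Complex_Main
begin

text \<open>Infinite words over a finite alphabet are modelled as functions nat => nat
  with finite range (every finite alphabet embeds into nat; using a fixed
  letter type lets the constant be independent of the alphabet).\<close>

definition occurs_at :: "(nat \<Rightarrow> 'a) \<Rightarrow> nat \<Rightarrow> nat \<Rightarrow> nat \<Rightarrow> bool" where
  "occurs_at w i m p \<longleftrightarrow> (\<forall>j<m. w (p + j) = w (i + j))"

definition appearance_bound :: "(nat \<Rightarrow> 'a) \<Rightarrow> real \<Rightarrow> bool" where
  "appearance_bound w C \<longleftrightarrow>
     (\<forall>m\<ge>1. \<forall>i. \<exists>p. occurs_at w i m p \<and> real (p + m) \<le> C * real m)"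

definition appearance_const :: "(nat \<Rightarrow> 'a) \<Rightarrow> real" where
  "appearance_const w = Inf {C. appearance_bound w C}"

definition recurrence_bound :: "(nat \<Rightarrow> 'a) \<Rightarrow> real \<Rightarrow> bool" where
  "recurrence_bound w C \<longleftrightarrow>
     (\<forall>m\<ge>1. \<forall>i.
        (\<exists>p. occurs_at w i m p \<and> real p \<le> C * real m) \<and>
        (\<forall>p. occurs_at w i m p \<longrightarrow>
              (\<exists>q>p. occurs_at w i m q \<and> real (q - p) \<le> C * real m)))"

definition uniformly_recurrent_inf :: "(nat \<Rightarrow> 'a) \<Rightarrow> bool" where
  "uniformly_recurrent_inf w \<longleftrightarrow> (\<forall>i m. infinite {p. occurs_at w i m p})"

definition linearly_recurrent :: "(nat \<Rightarrow> 'a) \<Rightarrow> bool" where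
  "linearly_recurrent w \<longleftrightarrow> uniformly_recurrent_inf w \<and> (\<exists>C. recurrence_bound w C)"

definition recurrence_const :: "(nat \<Rightarrow> 'a) \<Rightarrow> real" where
  "recurrence_const w = Inf {C. recurrence_bound w C}"

definition string_attractor :: "(nat \<Rightarrow> 'a) \<Rightarrow> nat \<Rightarrow> nat set \<Rightarrow> bool" where
  "string_attractor w n S \<longleftrightarrow> S \<subseteq> {0..<n} \<and>
     (\<forall>i m. m \<ge> 1 \<longrightarrow> i + m \<le> n \<longrightarrow>
        (\<exists>p s. p + m \<le> n \<and> occurs_at w i m p \<and> s \<in> S \<and> p \<le> s \<and> s < p + m))"

end

theory Submission
  imports Defs
begin

text \<open>
  Let \<open>A\<close> and \<open>R\<close> be the appearance and recurrence constants. The first occurrence of a factor of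
  length about \<open>2 ^ (k + 1)\<close> ends before \<open>O(A 2 ^ k)\<close> and contains one of the \<open>O(A)\<close> windows
  \<open>[j 2 ^ k, (j + 1) 2 ^ k)\<close>, so one point per window handles a single scale \<open>k\<close>. The point inside
  a window is free, and this lets one point serve many scales: if \<open>2 ^ L \<ge> c A R\<close>, every window of
  scale \<open>k + L\<close> contains a copy of the whole prefix of length \<open>O(A 2 ^ k)\<close>, hence a point that is
  the image of the chosen point of the \<open>j\<close>-th window of scale \<open>k\<close>. Iterating, one point per
  index \<open>j\<close> and residue class of scales modulo \<open>L\<close> suffices, and \<open>A \<le> R + 1\<close> gives \<open>L = O(1 + ln R)\<close>.
\<close>

section \<open>Occurrences and the two linear bounds\<close>

lemma occurs_at_refl: "occurs_at w i m i"
  by (simp add: occurs_at_def)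

lemma occurs_at_prefix_shift:
  assumes "occurs_at w i m p" "occurs_at w 0 l q" "p + m \<le> l"
  shows "occurs_at w i m (q + p)"
  unfolding occurs_at_def
proof (intro allI impI)
  fix j assume "j < m"
  then have "w (q + (p + j)) = w (0 + (p + j))" "w (p + j) = w (i + j)"
    using assms unfolding occurs_at_def by auto
  then show "w (q + p + j) = w (i + j)" by (simp add: add.assoc)
qed

lemma recurrence_bound_ge_1:
  assumes "recurrence_bound w C"
  shows "C \<ge> 1"
proof -
  obtain q where "q > 0" "real (q - 0) \<le> C * real 1"
    using assms occurs_at_refl[of w 0 1] unfolding recurrence_bound_def by blast
  then show ?thesis by simp
qed

lemma appearance_bound_ge_1:
  assumes "appearance_bound w C"
  shows "C \<ge> 1"
proof -
  obtain p where "real (p + 1) \<le> C * real 1"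
    using assms unfolding appearance_bound_def by blast
  then show ?thesis by simp
qed

text \<open>The end of an occurrence lies \<open>m\<close> beyond its start, hence the
  \<open>+ 1\<close>. This comparison lets the logarithm of \<open>R\<close> absorb that of
  \<open>A\<close>.\<close>

lemma appearance_bound_of_recurrence_bound:
  assumes "recurrence_bound w C"
  shows "appearance_bound w (C + 1)"
  unfolding appearance_bound_def
proof (intro allI impI)
  fix m i :: nat assume "m \<ge> 1"
  then obtain p where "occurs_at w i m p" "real p \<le> C * real m"
    using assms unfolding recurrence_bound_def by blast
  then show "\<exists>p. occurs_at w i m p \<and> real (p + m) \<le> (C + 1) * real m"
    by (intro exI[of _ p]) (simp add: algebra_simps)
qed

text \<open>The successor of the last occurrence before \<open>x\<close> cannot lie before
  \<open>x\<close>; if nothing occurs before \<open>x\<close>, the bound on the first occurrence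
  applies.\<close>

lemma recurrence_bound_occurs_after:
  assumes "recurrence_bound w C" "m \<ge> 1"
  shows "\<exists>q\<ge>x. occurs_at w i m q \<and> real q \<le> real x + C * real m"
proof (cases "\<exists>p<x. occurs_at w i m p")
  case True
  define p where "p = Max {p. p < x \<and> occurs_at w i m p}"
  have fin: "finite {p. p < x \<and> occurs_at w i m p}" by simp
  have p: "p < x" "occurs_at w i m p"
    using Max_in[OF fin] True unfolding p_def by auto
  obtain q where q: "q > p" "occurs_at w i m q" "real (q - p) \<le> C * real m"
    using assms p(2) unfolding recurrence_bound_def by blast
  have "q \<ge> x"
  proof (rule ccontr)
    assume "\<not> q \<ge> x"
    then have "q \<le> p" unfolding p_def using q(2) by (intro Max_ge[OF fin]) simp
    with q(1) show False by simp
  qed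
  with q p(1) show ?thesis by (intro exI[of _ q]) (simp add: of_nat_diff)
next
  case False
  obtain p where "occurs_at w i m p" "real p \<le> C * real m"
    using assms unfolding recurrence_bound_def by blast
  with False show ?thesis by (intro exI[of _ p]) (auto simp: not_less)
qed

section \<open>Dyadic windows and points shared across scales\<close>

definition window :: "nat \<Rightarrow> nat \<Rightarrow> nat set" where
  "window j k = {j * 2 ^ k ..< (j + 1) * 2 ^ k}"

text \<open>With \<open>2 ^ k\<close> between about a quarter and a half of \<open>m\<close>, every
  interval of length \<open>m\<close> has room for an aligned window, while the index
  \<open>j\<close> stays bounded in terms of \<open>N\<close> alone.\<close>

lemma window_covered:
  fixes p m N :: nat
  assumes "m \<ge> 1" "p + m \<le> N * m"
  obtains k j where "m < 4 * 2 ^ k" "j < 4 * N" "window j k \<subseteq> {p..<p + m}"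
    "(j + 1) * 2 ^ k \<le> p + m"
proof -
  \<comment> \<open>Rounding \<open>p\<close> up to a multiple of \<open>g\<close> loses at most
    \<open>g - 1\<close>, so \<open>2 * g \<le> m + 1\<close> suffices; hence the comparison with
    \<open>m + 1\<close>.\<close>
  obtain k' where k': "2 ^ k' \<le> m + 1" "m + 1 < 2 ^ (k' + 1)"
    using ex_power_ivl1[of 2 "m + 1"] by auto
  with assms(1) have "k' \<noteq> 0" by (intro notI) simp
  then obtain k where "k' = Suc k" using not0_implies_Suc by blast
  with k' have k: "2 * 2 ^ k \<le> m + 1" "m + 1 < 4 * 2 ^ k" by auto
  define g where "g = (2::nat) ^ k"
  have g: "g > 0" by (simp add: g_def)
  define j where "j = (p + g - 1) div g"
  have eq: "j * g + (p + g - 1) mod g = p + g - 1"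
    by (simp add: j_def)
  moreover have "(p + g - 1) mod g < g" using g by simp
  ultimately have jg: "p \<le> j * g" "j * g + g \<le> p + 2 * g - 1"
    using g by linarith+
  have le: "(j + 1) * g \<le> p + m"
    using jg(2) k(1) by (simp add: g_def)
  have "(j + 1) * g \<le> N * m" using le assms(2) by linarith
  also have "\<dots> \<le> N * (4 * g)" using k(2) by (intro mult_left_mono) (auto simp: g_def)
  finally have "(j + 1) * g \<le> (4 * N) * g" by (simp add: ac_simps)
  then have "j + 1 \<le> 4 * N" using g by (simp only: mult_le_cancel2)
  then have "j < 4 * N" by simp
  moreover have "window j k \<subseteq> {p..<p + m}"
    using jg(1) le by (auto simp: window_def g_def)
  ultimately show ?thesis using that[of k j] k(2) le by (simp add: g_def)
qed

text \<open>The images of the points chosen at the lower scales must stay below the right end of the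
  window, which is all that is known to lie inside the finite prefix under consideration.\<close>

lemma nested_window_point:
  assumes after: "\<And>m x. m \<ge> 1 \<Longrightarrow> \<exists>q\<ge>x. occurs_at w 0 m q \<and> q + m \<le> x + M * m"
    and L: "4 * M * N \<le> 2 ^ L" and j: "j < 4 * N"
  shows "\<exists>s \<in> window j (r + t * L). \<forall>t'<t. \<exists>q\<le>s.
    occurs_at w 0 (4 * N * 2 ^ (r + t' * L)) q \<and>
    q + 4 * N * 2 ^ (r + t' * L) \<le> (j + 1) * 2 ^ (r + t * L) \<and>
    s - q \<in> window j (r + t' * L)"
proof (induction t)
  case 0
  show ?case by (rule bexI[of _ "j * 2 ^ r"]) (auto simp: window_def)
next
  case (Suc t)
  let ?k = "\<lambda>t. r + t * L"
  let ?P = "\<lambda>t. 4 * N * 2 ^ ?k t"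
  obtain s where s: "s \<in> window j (?k t)"
    and low: "\<And>t'. t' < t \<Longrightarrow> \<exists>q\<le>s. occurs_at w 0 (?P t') q \<and>
      q + ?P t' \<le> (j + 1) * 2 ^ ?k t \<and> s - q \<in> window j (?k t')"
    using Suc.IH by blast
  \<comment> \<open>The window ends inside the prefix of length \<open>?P t\<close>, so a copy of
    that prefix carries along \<open>s\<close> and all prefix copies already placed around
    it.\<close>
  have end_le: "(j + 1) * 2 ^ ?k t \<le> ?P t"
    using j by (intro mult_right_mono) auto
  have "?P t \<ge> 1" using j by simp
  then obtain q0 where q0: "q0 \<ge> j * 2 ^ ?k (Suc t)" "occurs_at w 0 (?P t) q0"
    "q0 + ?P t \<le> j * 2 ^ ?k (Suc t) + M * ?P t"
    using after by blast
  \<comment> \<open>The choice of \<open>L\<close> makes the next copy of that prefix end inside the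
    window of scale \<open>?k (Suc t)\<close>.\<close>
  have "M * ?P t = (4 * M * N) * 2 ^ ?k t" by simp
  also have "\<dots> \<le> 2 ^ L * 2 ^ ?k t" using L by (rule mult_right_mono) simp
  also have "\<dots> = 2 ^ ?k (Suc t)" by (simp add: power_add)
  finally have q0_end: "q0 + ?P t \<le> (j + 1) * 2 ^ ?k (Suc t)"
    using q0(3) by (simp only: add_mult_distrib mult_1)
  have s_less: "s < ?P t"
    using s end_le unfolding window_def atLeastLessThan_iff by linarith
  have "q0 + s \<in> window j (?k (Suc t))"
    using q0(1) q0_end s_less unfolding window_def atLeastLessThan_iff by linarith
  moreover have "\<exists>q\<le>q0 + s. occurs_at w 0 (?P t') q \<and>
      q + ?P t' \<le> (j + 1) * 2 ^ ?k (Suc t) \<and> q0 + s - q \<in> window j (?k t')"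
    if "t' < Suc t" for t'
  \<comment> \<open>Scale \<open>t\<close> is served by the new copy itself, lower scales by the
    copies nested in it.\<close>
  proof (cases "t' = t")
    case True
    then show ?thesis using q0(2) q0_end s by (intro exI[of _ q0]) simp
  next
    case False
    with that obtain q where q: "q \<le> s" "occurs_at w 0 (?P t') q"
      "q + ?P t' \<le> (j + 1) * 2 ^ ?k t" "s - q \<in> window j (?k t')"
      using low[of t'] by auto
    have le: "q + ?P t' \<le> ?P t" using q(3) end_le by (rule le_trans)
    have "occurs_at w 0 (?P t') (q0 + q)"
      using occurs_at_prefix_shift[OF q(2) q0(2) le] .
    moreover have "q0 + q + ?P t' \<le> (j + 1) * 2 ^ ?k (Suc t)"
      using le q0_end by linarith
    ultimately show ?thesis using q(1,4) by (intro exI[of _ "q0 + q"]) simp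
  qed
  ultimately show ?case by blast
qed

section \<open>Assembling the attractor\<close>

text \<open>Each pair \<open>(j, r)\<close> contributes the nested point of its largest scale whose
  window ends by \<open>n\<close>; this point serves all lower scales of the class as well.\<close>

lemma string_attractor_exists:
  assumes app: "\<And>m i. m \<ge> 1 \<Longrightarrow> \<exists>p. occurs_at w i m p \<and> p + m \<le> N * m"
    and after: "\<And>m x. m \<ge> 1 \<Longrightarrow> \<exists>q\<ge>x. occurs_at w 0 m q \<and> q + m \<le> x + M * m"
    and L: "4 * M * N \<le> 2 ^ L" "L \<ge> 1"
  shows "\<exists>S. string_attractor w n S \<and> card S \<le> 4 * N * L"
proof -
  let ?k = "\<lambda>r t. r + t * L"
  let ?P = "\<lambda>r t. 4 * N * 2 ^ ?k r t"
  define fits where "fits j r t \<longleftrightarrow> (j + 1) * 2 ^ ?k r t \<le> n" for j r t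
  define top where "top j r = (GREATEST t. fits j r t)" for j r
  have fits_bound: "t \<le> n" if "fits j r t" for j r t
  proof -
    have "t \<le> ?k r t" using L(2) by (simp add: trans_le_add2)
    also have "\<dots> < 2 ^ ?k r t" by (rule less_exp)
    also have "\<dots> \<le> (j + 1) * 2 ^ ?k r t" by simp
    also have "\<dots> \<le> n" using that by (simp only: fits_def)
    finally show ?thesis by simp
  qed
  have top: "fits j r (top j r)" "t \<le> top j r" if "fits j r t" for j r t
    using GreatestI_nat[of "fits j r" t n] Greatest_le_nat[of "fits j r" t n]
      fits_bound that unfolding top_def by auto
  define good where "good j r s \<longleftrightarrow> s \<in> window j (?k r (top j r)) \<and>
    (\<forall>t'<top j r. \<exists>q\<le>s. occurs_at w 0 (?P r t') q \<and>
      q + ?P r t' \<le> (j + 1) * 2 ^ ?k r (top j r) \<and> s - q \<in> window j (?k r t'))" for j r s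
  define pt where "pt j r = (SOME s. good j r s)" for j r
  have pt: "good j r (pt j r)" if "j < 4 * N" for j r
    unfolding pt_def
    using nested_window_point[OF after L(1) that, of r "top j r"]
    by (intro someI_ex[of "good j r"]) (auto simp: good_def)
  \<comment> \<open>If no window of a pair fits, \<open>top\<close> is unspecified and the point may
    lie beyond the prefix; the intersection discards it.\<close>
  define S where "S = (\<lambda>(j, r). pt j r) ` ({..<4 * N} \<times> {..<L}) \<inter> {0..<n}"
  have "card S \<le> card ((\<lambda>(j, r). pt j r) ` ({..<4 * N} \<times> {..<L}))"
    unfolding S_def by (intro card_mono) auto
  also have "\<dots> \<le> card ({..<4 * N} \<times> {..<L})" by (rule card_image_le) simp
  finally have "card S \<le> 4 * N * L" by simp
  moreover have "string_attractor w n S"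
    unfolding string_attractor_def
  proof (intro conjI allI impI)
    show "S \<subseteq> {0..<n}" by (auto simp: S_def)
    fix i m :: nat assume m: "m \<ge> 1" and im: "i + m \<le> n"
    \<comment> \<open>The first occurrence ends both by \<open>n\<close>, compared with the one at
      \<open>i\<close>, and by \<open>N * m\<close>, compared with the one from
      \<open>app\<close>.\<close>
    define p where "p = (LEAST p. occurs_at w i m p)"
    have p: "occurs_at w i m p"
      unfolding p_def using occurs_at_refl by (rule LeastI)
    have p_le: "p \<le> p'" if "occurs_at w i m p'" for p'
      unfolding p_def using that by (rule Least_le)
    have pn: "p + m \<le> n" using p_le[OF occurs_at_refl] im by linarith
    obtain p' where "occurs_at w i m p'" "p' + m \<le> N * m" using app m by blast
    then have pN: "p + m \<le> N * m" using p_le by fastforce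
    obtain k j where kj: "m < 4 * 2 ^ k" "j < 4 * N" "window j k \<subseteq> {p..<p + m}"
      "(j + 1) * 2 ^ k \<le> p + m"
      by (rule window_covered[OF m pN])
    define r t where "r = k mod L" and "t = k div L"
    have k: "k = ?k r t" by (simp add: r_def t_def)
    have r: "r < L" using L(2) by (simp add: r_def)
    have fits: "fits j r t" unfolding fits_def k[symmetric] using kj(4) pn by linarith
    note t_le = top(2)[OF fits]
    have top_end: "(j + 1) * 2 ^ ?k r (top j r) \<le> n"
      using top(1)[OF fits] by (simp only: fits_def)
    define s where "s = pt j r"
    have s: "s \<in> window j (?k r (top j r))"
      and low: "\<And>t'. t' < top j r \<Longrightarrow> \<exists>q\<le>s. occurs_at w 0 (?P r t') q \<and>
        q + ?P r t' \<le> (j + 1) * 2 ^ ?k r (top j r) \<and> s - q \<in> window j (?k r t')"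
      using pt[OF kj(2), of r] unfolding good_def s_def by auto
    have "s < n" using s top_end unfolding window_def atLeastLessThan_iff by linarith
    then have sS: "s \<in> S" using kj(2) r by (auto simp: S_def s_def)
    show "\<exists>p s. p + m \<le> n \<and> occurs_at w i m p \<and> s \<in> S \<and> p \<le> s \<and> s < p + m"
    proof (cases "t = top j r")
      case True
      then have "s \<in> window j k" using s k by simp
      then have "p \<le> s" "s < p + m" using kj(3) by auto
      then show ?thesis using pn p sS by blast
    next
      case False
      with t_le obtain q where q: "q \<le> s" "occurs_at w 0 (?P r t) q"
        "q + ?P r t \<le> (j + 1) * 2 ^ ?k r (top j r)" "s - q \<in> window j (?k r t)"
        using low[of t] by auto
      \<comment> \<open>The first occurrence lies in the prefix of length \<open>?P r t\<close>, so
        the copy of that prefix at \<open>q\<close> contains its translate, and \<open>s - q\<close>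
        in the covered window puts \<open>s\<close> inside that translate.\<close>
      note pN
      also have "N * m \<le> N * (4 * 2 ^ k)" using kj(1) by (intro mult_left_mono) auto
      also have "\<dots> = ?P r t" using k by simp
      finally have "occurs_at w i m (q + p)" "q + p + m \<le> n"
        using occurs_at_prefix_shift[OF p q(2)] q(3) top_end by linarith+
      moreover have "p \<le> s - q" "s - q < p + m" using kj(3) q(4) k by auto
      then have "q + p \<le> s" "s < q + p + m" using q(1) by linarith+
      ultimately show ?thesis using sS by blast
    qed
  qed
  ultimately show ?thesis by blast
qed

section \<open>From the infima to integer bounds\<close>

lemma appearance_const_ge_1:
  assumes "appearance_bound w C"
  shows "appearance_const w \<ge> 1"
  unfolding appearance_const_def
  using assms appearance_bound_ge_1 by (intro cInf_greatest) auto

lemma appearance_const_le: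
  assumes "appearance_bound w C"
  shows "appearance_const w \<le> C"
  unfolding appearance_const_def
  using assms appearance_bound_ge_1 by (intro cInf_lower) (auto intro!: bdd_belowI[of _ 1])

lemma recurrence_const_ge_1:
  assumes "recurrence_bound w C"
  shows "recurrence_const w \<ge> 1"
  unfolding recurrence_const_def
  using assms recurrence_bound_ge_1 by (intro cInf_greatest) auto

text \<open>Some valid bound lies within 1 of the infimum, and rounding it up costs less than 1
  more; attainment of the infimum is never at issue.\<close>

lemma nat_appearance_bound:
  assumes "appearance_bound w C"
  obtains N :: nat where "N \<le> appearance_const w + 2"
    "\<And>m i. m \<ge> 1 \<Longrightarrow> \<exists>p. occurs_at w i m p \<and> p + m \<le> N * m"
proof -
  have "\<exists>D\<in>{C. appearance_bound w C}. D < appearance_const w + 1"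
    unfolding appearance_const_def using assms by (intro cInf_lessD) auto
  then obtain D where D: "appearance_bound w D" "D < appearance_const w + 1" by auto
  define N where "N = nat \<lceil>D\<rceil>"
  have N: "D \<le> N" "N < D + 1" using appearance_bound_ge_1[OF D(1)] by (simp_all add: N_def) linarith+
  have "\<exists>p. occurs_at w i m p \<and> p + m \<le> N * m" if m: "m \<ge> 1" for m i
  proof -
    obtain p where p: "occurs_at w i m p" "real (p + m) \<le> D * real m"
      using D(1) m unfolding appearance_bound_def by blast
    note p(2)
    also have "D * real m \<le> real N * real m" using N(1) by (rule mult_right_mono) simp
    finally have "p + m \<le> N * m" by (simp only: of_nat_mult[symmetric] of_nat_le_iff)
    with p(1) show ?thesis by blast
  qed
  then show ?thesis using that[of N] N D(2) by auto
qed

text \<open>Besides the slack for the infimum and the rounding, \<open>M\<close> has one extra unit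
  because it bounds the end of the occurrence.\<close>

lemma nat_recurrence_bound:
  assumes "recurrence_bound w C"
  obtains M :: nat where "M \<le> recurrence_const w + 3"
    "appearance_const w \<le> recurrence_const w + 2"
    "\<And>m i x. m \<ge> 1 \<Longrightarrow> \<exists>q\<ge>x. occurs_at w i m q \<and> q + m \<le> x + M * m"
proof -
  have "\<exists>D\<in>{C. recurrence_bound w C}. D < recurrence_const w + 1"
    unfolding recurrence_const_def using assms by (intro cInf_lessD) auto
  then obtain D where D: "recurrence_bound w D" "D < recurrence_const w + 1" by auto
  define M where "M = nat \<lceil>D + 1\<rceil>"
  have M: "D + 1 \<le> M" "M < D + 2"
    using recurrence_bound_ge_1[OF D(1)] by (simp_all add: M_def) linarith+
  have "\<exists>q\<ge>x. occurs_at w i m q \<and> q + m \<le> x + M * m" if m: "m \<ge> 1" for m i x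
  proof -
    obtain q where q: "q \<ge> x" "occurs_at w i m q" "real q \<le> real x + D * real m"
      using recurrence_bound_occurs_after[OF D(1) m] by blast
    have "real (q + m) \<le> real x + (D + 1) * real m" using q(3) by (simp add: algebra_simps)
    also have "\<dots> \<le> real x + real M * real m"
      using M(1) by (intro add_left_mono mult_right_mono) auto
    finally have "q + m \<le> x + M * m"
      by (simp only: of_nat_mult[symmetric] of_nat_add[symmetric] of_nat_le_iff)
    with q show ?thesis by blast
  qed
  moreover have "appearance_const w \<le> recurrence_const w + 2"
    using appearance_const_le[OF appearance_bound_of_recurrence_bound[OF D(1)]] D(2) by linarith
  ultimately show ?thesis using that[of M] M D(2) by auto
qed

section \<open>The logarithmic estimate and the conclusion\<close>

lemma power_two_ge_exponent_le:
  fixes x :: nat and R a :: real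
  assumes "x \<le> a * R\<^sup>2" "R \<ge> 1" "a \<ge> 1"
  obtains L where "L \<ge> 1" "x \<le> 2 ^ L" "L \<le> (3 + log 2 a) * (1 + ln R) + ln R"
proof -
  define y where "y = log 2 (a * R\<^sup>2)"
  have pos: "a * R\<^sup>2 > 0" using assms by simp
  have y: "y = log 2 a + 2 * log 2 R"
    using assms by (simp add: y_def log_mult log_nat_power)
  have la: "log 2 a \<ge> 0" and lR: "log 2 R \<ge> 0" "ln R \<ge> 0" using assms by auto
  \<comment> \<open>The added 1 ensures \<open>L \<ge> 1\<close> even when
    \<open>y = 0\<close>.\<close>
  define L where "L = nat \<lceil>y\<rceil> + 1"
  have Ly: "y \<le> L" "L \<le> y + 2" using la lR by (simp_all add: L_def y) linarith+
  have "real x \<le> 2 powr y" using assms pos by (simp add: y_def)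
  also have "\<dots> \<le> 2 powr L" using Ly(1) by simp
  also have "\<dots> = real (2 ^ L)" by (simp add: powr_realpow)
  finally have "x \<le> 2 ^ L" by (simp only: of_nat_le_iff)
  moreover have "L \<le> (3 + log 2 a) * (1 + ln R) + ln R"
  proof -
    \<comment> \<open>\<open>ln (1 / 2) \<le> - 1 / 2\<close> gives \<open>ln 2 \<ge> 1 / 2\<close>,
      which turns the binary logarithm into at most twice the natural one.\<close>
    have "2 * ln 2 \<ge> (1::real)"
      using ln_le_minus_one[of "1 / 2 :: real"] by (simp add: ln_div)
    then have "ln R \<le> ln R * (2 * ln 2)"
      using mult_left_mono[of 1 "2 * ln 2" "ln R"] lR(2) by simp
    then have "log 2 R \<le> 2 * ln R" by (simp add: log_def divide_le_eq ac_simps)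
    then have "L \<le> 2 + log 2 a + 4 * ln R" using Ly(2) y by linarith
    also have "\<dots> \<le> (3 + log 2 a) * (1 + ln R) + ln R"
      using la lR(2) by (simp add: algebra_simps)
    finally show ?thesis .
  qed
  ultimately show ?thesis using that[of L] by (simp add: L_def)
qed

theorem theorem17:
  "\<exists>K::real. \<forall>w :: nat \<Rightarrow> nat.
     finite (range w) \<and> linearly_recurrent w \<and> (\<exists>C. appearance_bound w C) \<longrightarrow>
     (\<forall>n\<ge>1. \<exists>S. string_attractor w n S \<and>
        real (card S) \<le> K * appearance_const w * (1 + ln (recurrence_const w)))"
\<comment> \<open>The 12 comes from \<open>4 * (A + 2) \<le> 12 * A\<close>, the other factor from
  the bound on \<open>L\<close>.\<close>
proof (intro exI[of _ "12 * (4 + log 2 80)"] allI impI)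
  fix w :: "nat \<Rightarrow> nat" and n :: nat
  assume "finite (range w) \<and> linearly_recurrent w \<and> (\<exists>C. appearance_bound w C)"
  then obtain C C' where C: "recurrence_bound w C" and C': "appearance_bound w C'"
    unfolding linearly_recurrent_def by blast
  define A R where "A = appearance_const w" and "R = recurrence_const w"
  have A: "A \<ge> 1" and R: "R \<ge> 1"
    using appearance_const_ge_1[OF C'] recurrence_const_ge_1[OF C] by (simp_all add: A_def R_def)
  obtain N where N: "real N \<le> A + 2"
    "\<And>m i. m \<ge> 1 \<Longrightarrow> \<exists>p. occurs_at w i m p \<and> p + m \<le> N * m"
    using nat_appearance_bound[OF C'] unfolding A_def by metis
  obtain M where M: "real M \<le> R + 3" "A \<le> R + 2"
    "\<And>m i x. m \<ge> 1 \<Longrightarrow> \<exists>q\<ge>x. occurs_at w i m q \<and> q + m \<le> x + M * m"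
    using nat_recurrence_bound[OF C] unfolding A_def R_def by metis
  \<comment> \<open>Since \<open>R \<ge> 1\<close>, \<open>M \<le> R + 3 \<le> 4 * R\<close> and
    \<open>N \<le> A + 2 \<le> R + 4 \<le> 5 * R\<close>; this is the origin of 80.\<close>
  have "real M * real N \<le> (4 * R) * (5 * R)"
    using N(1) M(1,2) R by (intro mult_mono) auto
  then have "real (4 * M * N) \<le> 80 * R\<^sup>2" by (simp add: power2_eq_square)
  then obtain L where L: "L \<ge> 1" "4 * M * N \<le> 2 ^ L"
    "real L \<le> (3 + log 2 80) * (1 + ln R) + ln R"
    using power_two_ge_exponent_le[of "4 * M * N" 80 R] R by auto
  obtain S where S: "string_attractor w n S" "card S \<le> 4 * N * L"
    using string_attractor_exists[OF N(2) M(3) L(2,1)] by blast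
  have "real (card S) \<le> real (4 * N * L)" using S(2) by (simp only: of_nat_le_iff)
  also have "\<dots> = (4 * real N) * real L" by simp
  also have "\<dots> \<le> (12 * A) * ((4 + log 2 80) * (1 + ln R))"
  proof (rule mult_mono)
    show "4 * real N \<le> 12 * A" using N(1) A by linarith
    show "real L \<le> (4 + log 2 80) * (1 + ln R)" using L(3) by (simp add: algebra_simps)
  qed (use A in auto)
  finally have "real (card S) \<le> 12 * (4 + log 2 80) * A * (1 + ln R)"
    by (simp add: ac_simps)
  with S(1) show "\<exists>S. string_attractor w n S \<and>
      real (card S) \<le> 12 * (4 + log 2 80) * appearance_const w * (1 + ln (recurrence_const w))"
    unfolding A_def R_def by blast
qed

end
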